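(* As formal power series in $q$ (equivalently, for complex $q$ with $|q|<1$), $$\sum_{n\ge 0}\frac{q^{2n^2-n}}{(q;q)_{2n}}=\frac{1}{(q;q)_\infty}\sum_{k\in\mathbb{Z}}(-1)^kq^{3k^2-k}=\frac{(q^2;q^2)_\infty}{(q;q)_\infty}=(-q;q)_\infty .$$
   Context: $(z;q)_n=\prod_{j=0}^{n-1}(1-q^jz)$ and $(z;q)_\infty=\prod_{j\ge0}(1-q^jz)$; thus $(q;q)_\infty=\prod_{j\ge1}(1-q^j)$, $(q^2;q^2)_\infty=\prod_{j\ge1}(1-q^{2j})$, $(-q;q)_\infty=\prod_{j\ge1}(1+q^j)$. *)

theory Defs
  imports "HOL-Analysis.Analysis" "HOL-Computational_Algebra.Formal_Power_Series"
begin

definition qpoch :: "'a::comm_ring_1 \<Rightarrow> 'a \<Rightarrow> nat \<Rightarrow> 'a" where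
  "qpoch z q n = (\<Prod>j<n. 1 - q ^ j * z)"

text \<open>The type class constraint covers both the complex numbers and formal power series, the
  latter with the X-adic topology. As usual for \<^const>\<open>prodinf\<close>, the value is meaningful
  only if the product converges.\<close>

definition qpoch_inf :: "'a::{t2_space, comm_ring_1} \<Rightarrow> 'a \<Rightarrow> 'a" where
  "qpoch_inf z q = (\<Prod>j. 1 - q ^ j * z)"

end

theory Submission
  imports Defs
begin

text \<open>
  Let \<open>F z\<close> be the sum of \<open>q ^ (n choose 2) * z ^ n / qpoch q q n\<close> over all \<open>n\<close>. Its coefficients
  satisfy a recurrence which amounts to \<open>F z = (1 + z) * F (q * z)\<close>, so \<open>F 1\<close> is the product of all
  \<open>1 + q ^ j\<close>, which is \<open>2 * qpoch_inf (- q) q\<close>, while \<open>F (- 1) = 0\<close>. In \<open>F 1 + F (- 1)\<close> only the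
  even terms survive, each of them twice; this evaluates the sum over \<open>n\<close>.
  The sum over \<open>k\<close> is Euler's pentagonal number theorem for the base \<open>q\<^sup>2\<close>. It is the limit of a
  polynomial identity of Shanks, one side of which is \<open>qpoch p p n\<close> up to an error of order \<open>n * p ^ n\<close>.

  The only analytic input is a complete submultiplicative absolute value with \<open>\<bar>q\<bar> < 1\<close> for which
  elements close to \<open>1\<close> are units. Both the complex numbers and formal power series have one, so
  the two halves of the theorem are instances of one statement.
\<close>

section \<open>Integral domains with a complete absolute value\<close>

text \<open>\<open>dist\<close> and \<open>div\<close> are operations that both types of the theorem
  share, so the absolute value is expressed as the distance to 0. Characteristic zero serves to
  cancel the factor 2 in \<open>F 1 + F (- 1)\<close>.\<close>

class normed_idom = idom_divide + semiring_char_0 + complete_space +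
  assumes dist_eq_dist_diff: "dist x y = dist (x - y) 0"
    and dist_mult_zero_le: "dist (x * y) 0 \<le> dist x 0 * dist y 0"
    and dist_one_zero: "dist 1 0 = 1"
    and dvd_one_if_dist_less: "dist x 1 < 1 \<Longrightarrow> x dvd 1"

instance complex :: normed_idom
proof
  fix x y :: complex
  show "dist x y = dist (x - y) 0" by (simp add: dist_norm)
  show "dist (x * y) 0 \<le> dist x 0 * dist y 0" by (simp add: norm_mult)
  show "dist (1::complex) 0 = 1" by simp
  assume "dist x 1 < 1"
  then show "x dvd 1" by (auto simp: dvd_field_iff dist_norm)
qed

instance fps :: (field_char_0) normed_idom
proof
  fix x y :: "'a fps"
  show "dist x y = dist (x - y) 0" by (simp add: dist_fps_def)
  show "dist (x * y) 0 \<le> dist x 0 * dist y 0"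
    by (auto simp: dist_fps_def subdegree_mult power_add)
  show "dist (1::'a fps) 0 = 1" by (simp add: dist_fps_def)
  assume "dist x 1 < 1"
  \<comment> \<open>Distance below \<open>1 = 1 / 2 ^ 0\<close> forces agreement in the constant
    coefficient.\<close>
  then have "fps_nth x 0 = 1"
    using dist_less_imp_nth_equal[of x 1 0 0] by simp
  then show "x dvd 1" by (simp add: fps_is_unit_iff)
qed

text \<open>The norm on the complex numbers; \<open>1 / 2 ^ subdegree x\<close> for a nonzero formal
  power series.\<close>

definition mag :: "'a::normed_idom \<Rightarrow> real" where
  "mag x = dist x 0"

lemma dist_eq_mag: "dist x y = mag (x - y)"
  unfolding mag_def by (rule dist_eq_dist_diff)

lemma mag_nonneg [simp]: "0 \<le> mag x"
  by (simp add: mag_def)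

lemma mag_zero [simp]: "mag 0 = 0"
  by (simp add: mag_def)

lemma mag_one [simp]: "mag 1 = 1"
  by (simp add: mag_def dist_one_zero)

lemma mag_minus [simp]: "mag (- x) = mag x"
  using dist_eq_mag[of 0 x] by (simp add: mag_def dist_commute)

lemma mag_add_le: "mag (x + y) \<le> mag x + mag y"
  using dist_triangle[of x "- y" 0] dist_eq_mag[of x "- y"] dist_eq_mag[of 0 "- y"]
  by (simp add: mag_def)

lemma mag_mult_le: "mag (x * y) \<le> mag x * mag y"
  unfolding mag_def by (rule dist_mult_zero_le)

lemma mag_power_le: "mag (x ^ n) \<le> mag x ^ n"
  by (induction n) (auto intro!: order_trans[OF mag_mult_le] mult_left_mono)

lemma mag_sum_le: "mag (sum f A) \<le> (\<Sum>x\<in>A. mag (f x))"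
  by (induction A rule: infinite_finite_induct)
     (auto intro!: order_trans[OF mag_add_le] add_left_mono)

lemma mag_prod_le: "mag (prod f A) \<le> (\<Prod>x\<in>A. mag (f x))"
  by (induction A rule: infinite_finite_induct)
     (auto intro!: order_trans[OF mag_mult_le] mult_left_mono)

lemma mag_minus_one_power [simp]: "mag ((- 1) ^ n) = 1"
  by (cases "even n") auto

lemma tendsto_normed_idom_iff: "(f \<longlongrightarrow> l) F \<longleftrightarrow> ((\<lambda>x. mag (f x - l)) \<longlongrightarrow> 0) F"
  using tendsto_dist_iff[of f l F] by (simp add: dist_eq_mag)

instance normed_idom \<subseteq> topological_ab_group_add
proof
  fix a b :: 'a
  show "((\<lambda>x. fst x + snd x) \<longlongrightarrow> a + b) (nhds a \<times>\<^sub>F nhds b)"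
    unfolding tendsto_normed_idom_iff
  proof (rule tendsto_sandwich[OF _ _ tendsto_const])
    \<comment> \<open>Stated with \<open>dist\<close>, whose continuity is among
      \<open>tendsto_intros\<close>, and rewritten to \<open>mag\<close> afterwards.\<close>
    have "((\<lambda>x. dist (fst x) a + dist (snd x) b) \<longlongrightarrow> dist a a + dist b b) (nhds a \<times>\<^sub>F nhds b)"
      by (intro tendsto_intros filterlim_fst filterlim_snd)
    then show "((\<lambda>x. mag (fst x - a) + mag (snd x - b)) \<longlongrightarrow> 0) (nhds a \<times>\<^sub>F nhds b)"
      by (simp add: dist_eq_mag)
    show "\<forall>\<^sub>F x in nhds a \<times>\<^sub>F nhds b.
        mag (fst x + snd x - (a + b)) \<le> mag (fst x - a) + mag (snd x - b)"
      using mag_add_le[of "fst x - a" "snd x - b" for x]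
      by (intro always_eventually allI) (metis add_diff_add)
  qed auto
  show "(uminus \<longlongrightarrow> - a) (nhds a)"
  proof -
    have "((\<lambda>x. mag (x - a)) \<longlongrightarrow> 0) (nhds a)"
      using tendsto_normed_idom_iff[of "\<lambda>x. x" a "nhds a"] by (simp add: filterlim_ident)
    moreover have "mag (- x - - a) = mag (x - a)" for x
      using mag_minus[of "x - a"] by (simp add: algebra_simps)
    ultimately show ?thesis
      unfolding tendsto_normed_idom_iff by simp
  qed
qed

instance normed_idom \<subseteq> topological_semigroup_mult
proof
  fix a b :: 'a
  show "((\<lambda>x. fst x * snd x) \<longlongrightarrow> a * b) (nhds a \<times>\<^sub>F nhds b)"
    unfolding tendsto_normed_idom_iff
  proof (rule tendsto_sandwich[OF _ _ tendsto_const])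
    have "((\<lambda>x. dist (fst x) a * dist (snd x) 0 + mag a * dist (snd x) b)
        \<longlongrightarrow> dist a a * dist b 0 + mag a * dist b b) (nhds a \<times>\<^sub>F nhds b)"
      by (intro tendsto_intros filterlim_fst filterlim_snd)
    then show "((\<lambda>x. mag (fst x - a) * mag (snd x) + mag a * mag (snd x - b)) \<longlongrightarrow> 0)
        (nhds a \<times>\<^sub>F nhds b)"
      by (simp add: dist_eq_mag)
    have "mag (x * y - a * b) \<le> mag (x - a) * mag y + mag a * mag (y - b)" for x y
    proof -
      have "x * y - a * b = (x - a) * y + a * (y - b)"
        by (simp add: algebra_simps)
      then show ?thesis
        using mag_add_le[of "(x - a) * y" "a * (y - b)"] mag_mult_le[of "x - a" y]
          mag_mult_le[of a "y - b"] by simp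
    qed
    then show "\<forall>\<^sub>F x in nhds a \<times>\<^sub>F nhds b.
        mag (fst x * snd x - a * b) \<le> mag (fst x - a) * mag (snd x) + mag a * mag (snd x - b)"
      by simp
  qed auto
qed

section \<open>Unconditional summation\<close>

text \<open>Past a finite set that carries nearly all of \<open>b\<close>, further terms change the
  sum by little. A limit along a single exhaustion therefore suffices: below it is
  \<open>lessThan\<close> on the naturals and symmetric intervals on the integers.\<close>

lemma has_sum_exhaustI:
  fixes f :: "'i \<Rightarrow> 'a::normed_idom"
  assumes b: "b summable_on UNIV" and fb: "\<And>i. mag (f i) \<le> b i"
    and A: "incseq A" "\<And>n. finite (A n)" "(\<Union>n. A n) = UNIV"
    and lim: "(\<lambda>n. sum f (A n)) \<longlonglongrightarrow> S"
  shows "(f has_sum S) UNIV"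
  unfolding has_sum_def tendsto_iff eventually_finite_subsets_at_top
proof (intro allI impI)
  fix e :: real
  assume "e > 0"
  define B where "B = infsum b UNIV"
  have "(b has_sum B) UNIV"
    using b by (simp add: B_def)
  \<comment> \<open>Two sums of \<open>b\<close> within \<open>e / 4\<close> of \<open>B\<close>
    differ by less than \<open>e / 2\<close>; the other half of \<open>e\<close> goes to the limit
    along \<open>A\<close>.\<close>
  then obtain X where X: "finite X" "\<And>F. finite F \<Longrightarrow> X \<subseteq> F \<Longrightarrow> dist (sum b F) B < e / 4"
    using \<open>e > 0\<close> unfolding has_sum_def tendsto_iff eventually_finite_subsets_at_top
    by (metis divide_pos_pos subset_UNIV zero_less_numeral)
  have "\<forall>\<^sub>F n in sequentially. dist (sum f (A n)) S < e / 2"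
    using lim \<open>e > 0\<close> by (intro tendstoD) auto
  moreover have "\<forall>\<^sub>F n in sequentially. X \<subseteq> A n"
  proof -
    have "\<exists>n. X \<subseteq> A n"
      using X(1)
    proof (induction X)
      case (insert x X)
      then obtain m n where "x \<in> A m" "X \<subseteq> A n"
        using A(3) by blast
      moreover have "A m \<subseteq> A (max m n)" "A n \<subseteq> A (max m n)"
        using A(1) by (simp_all add: incseqD)
      ultimately have "insert x X \<subseteq> A (max m n)"
        by blast
      then show ?case ..
    qed simp
    then show ?thesis
    proof
      fix n
      assume "X \<subseteq> A n"
      then show ?thesis
        using A(1) unfolding eventually_sequentially incseq_def by blast
    qed
  qed
  ultimately have "\<forall>\<^sub>F n in sequentially. dist (sum f (A n)) S < e / 2 \<and> X \<subseteq> A n"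
    by (rule eventually_conj)
  then obtain n where n: "dist (sum f (A n)) S < e / 2" "X \<subseteq> A n"
    using eventually_happens'[OF sequentially_bot] by blast
  have "dist (sum f F) S < e" if F: "finite F" "A n \<subseteq> F" for F
  proof -
    have "sum f F - sum f (A n) = sum f (F - A n)"
      using F A(2) by (simp add: sum_diff)
    then have "dist (sum f F) (sum f (A n)) \<le> sum b (F - A n)"
      unfolding dist_eq_mag by (metis (no_types, lifting) fb mag_sum_le order_trans sum_mono)
    also have "\<dots> = sum b F - sum b (A n)"
      using F A(2) by (simp add: sum_diff)
    also have "\<dots> < e / 2"
    proof -
      have "dist (sum b F) B < e / 4" "dist (sum b (A n)) B < e / 4"
        using X(2) F A(2) n(2) by blast+
      then show ?thesis
        unfolding dist_real_def by linarith
    qed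
    finally show ?thesis
      using n(1) dist_triangle[of "sum f F" S "sum f (A n)"] by linarith
  qed
  then show "\<exists>X. finite X \<and> X \<subseteq> UNIV \<and> (\<forall>Y. finite Y \<and> X \<subseteq> Y \<and> Y \<subseteq> UNIV \<longrightarrow> dist (sum f Y) S < e)"
    using A(2) by (intro exI[of _ "A n"]) simp
qed

section \<open>Convergence of infinite products\<close>

lemma Cauchy_if_summable_dist:
  fixes f :: "nat \<Rightarrow> 'a::metric_space"
  assumes "summable g" and g: "\<And>n. dist (f n) (f (Suc n)) \<le> g n"
  shows "Cauchy f"
  unfolding Cauchy_altdef
proof (intro allI impI)
  fix e :: real
  assume "e > 0"
  then obtain M where M: "\<And>m n. m \<ge> M \<Longrightarrow> norm (sum g {m..<n}) < e"
    using assms(1) unfolding summable_Cauchy by blast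
  have "dist (f m) (f n) \<le> sum g {m..<n}" if "m \<le> n" for m n
    using that
  proof (induction n rule: dec_induct)
    case (step n)
    then show ?case
      using dist_triangle[of "f m" "f (Suc n)" "f n"] g[of n] by simp
  qed simp
  then have "dist (f m) (f n) < e" if "m \<ge> M" "n > m" for m n
    using M[OF that(1), of n] that(2) by (smt (verit) less_imp_le real_norm_def)
  then show "\<exists>M. \<forall>m\<ge>M. \<forall>n>m. dist (f m) (f n) < e"
    by blast
qed

lemma mag_prod_one_plus_le: "mag (\<Prod>x\<in>A. 1 + a x) \<le> exp (\<Sum>x\<in>A. mag (a x))"
proof -
  have "mag (\<Prod>x\<in>A. 1 + a x) \<le> (\<Prod>x\<in>A. mag (1 + a x))"
    by (rule mag_prod_le)
  also have "\<dots> \<le> (\<Prod>x\<in>A. 1 + mag (a x))"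
    by (intro prod_mono conjI mag_nonneg order_trans[OF mag_add_le]) simp
  also have "\<dots> \<le> exp (\<Sum>x\<in>A. mag (a x))"
    by (rule prod_le_exp_sum) simp
  finally show ?thesis .
qed

text \<open>Quantifies how close to 1 a product with small \<open>a\<close> stays, so that
  \<open>dvd_one_if_dist_less\<close> can be applied to the tail of an infinite product.\<close>

lemma mag_prod_one_plus_diff_le:
  "mag ((\<Prod>x\<in>A. 1 + a x) - 1) \<le> exp (\<Sum>x\<in>A. mag (a x)) - 1"
proof (induction A rule: infinite_finite_induct)
  case (insert x A)
  let ?P = "\<Prod>x\<in>A. 1 + a x" and ?E = "exp (\<Sum>x\<in>A. mag (a x))"
  have "(\<Prod>x\<in>insert x A. 1 + a x) - 1 = (?P - 1) + a x * ?P"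
    using insert by (simp add: algebra_simps)
  then have "mag ((\<Prod>x\<in>insert x A. 1 + a x) - 1) \<le> mag (?P - 1) + mag (a x) * mag ?P"
    by (metis add_left_mono mag_add_le mag_mult_le order_trans)
  also have "\<dots> \<le> (?E - 1) + mag (a x) * ?E"
    by (intro add_mono insert.IH mult_left_mono mag_prod_one_plus_le mag_nonneg)
  also have "\<dots> = (1 + mag (a x)) * ?E - 1"
    by (simp add: algebra_simps)
  also have "\<dots> \<le> exp (mag (a x)) * ?E - 1"
    by (intro diff_right_mono mult_right_mono exp_ge_add_one_self) simp
  also have "\<dots> = exp (\<Sum>x\<in>insert x A. mag (a x)) - 1"
    using insert by (simp add: exp_add)
  finally show ?case .
qed auto

text \<open>Consecutive partial products differ by \<open>?P n * a n\<close>, and all of them are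
  bounded by the exponential of the total of \<open>mag (a n)\<close>.\<close>

lemma convergent_prod_one_plus:
  fixes a :: "nat \<Rightarrow> 'a::normed_idom"
  assumes a: "summable (\<lambda>n. mag (a n))"
  shows "convergent (\<lambda>n. \<Prod>i<n. 1 + a i)"
proof -
  let ?P = "\<lambda>n. \<Prod>i<n. 1 + a i" and ?E = "exp (\<Sum>n. mag (a n))"
  have "dist (?P n) (?P (Suc n)) \<le> ?E * mag (a n)" for n
  proof -
    have "?P (Suc n) - ?P n = ?P n * a n"
      by (simp add: algebra_simps)
    then have "dist (?P n) (?P (Suc n)) \<le> mag (?P n) * mag (a n)"
      by (metis dist_commute dist_eq_mag mag_mult_le)
    also have "\<dots> \<le> exp (\<Sum>i<n. mag (a i)) * mag (a n)"
      by (intro mult_right_mono mag_prod_one_plus_le mag_nonneg)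
    also have "\<dots> \<le> ?E * mag (a n)"
      using a by (intro mult_right_mono) (auto intro: sum_le_suminf)
    finally show ?thesis .
  qed
  then have "Cauchy ?P"
    by (rule Cauchy_if_summable_dist[rotated]) (intro summable_mult a)
  then show ?thesis
    by (rule Cauchy_convergent)
qed

text \<open>A limit of units can be 0, so the units are not simply passed to the limit. Instead
  finitely many factors are split off, a finite product of units, such that the remaining tail stays
  close to 1.\<close>

lemma tendsto_prod_one_plus_unit:
  fixes a :: "nat \<Rightarrow> 'a::normed_idom"
  assumes a: "summable (\<lambda>n. mag (a n))" and unit: "\<And>n. 1 + a n dvd 1"
    and L: "(\<lambda>n. \<Prod>i<n. 1 + a i) \<longlonglongrightarrow> L"
  shows "L dvd 1"
proof -
  \<comment> \<open>\<open>exp (ln (3 / 2)) - 1 = 1 / 2\<close>, which is still below 1 after the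
    passage to the limit, where only \<le> survives.\<close>
  have "\<forall>\<^sub>F M in sequentially. (\<Sum>n. mag (a (n + M))) < ln (3 / 2)"
    by (rule order_tendstoD[OF suminf_exist_split2[OF a]]) simp
  then obtain M where M: "(\<Sum>n. mag (a (n + M))) < ln (3 / 2)"
    using eventually_happens'[OF sequentially_bot] by blast
  have aM: "summable (\<lambda>n. mag (a (n + M)))"
    using a by (rule summable_ignore_initial_segment)
  obtain L' where L': "(\<lambda>n. \<Prod>i<n. 1 + a (i + M)) \<longlonglongrightarrow> L'"
    using convergent_prod_one_plus[OF aM] by (auto simp: convergent_def)
  have "dist (\<Prod>i<n. 1 + a (i + M)) 1 \<le> 1 / 2" for n
  proof -
    have "dist (\<Prod>i<n. 1 + a (i + M)) 1 \<le> exp (\<Sum>i<n. mag (a (i + M))) - 1"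
      unfolding dist_eq_mag by (rule mag_prod_one_plus_diff_le)
    also have "(\<Sum>i<n. mag (a (i + M))) \<le> ln (3 / 2)"
      using sum_le_suminf[OF aM, of "{..<n}"] M by auto
    finally show ?thesis by simp
  qed
  then have "dist L' 1 \<le> 1 / 2"
    by (intro LIMSEQ_le_const2[OF tendsto_dist[OF L' tendsto_const]]) blast
  then have "L' dvd 1"
    by (intro dvd_one_if_dist_less) simp
  moreover have "L = (\<Prod>i<M. 1 + a i) * L'"
  proof (rule LIMSEQ_unique)
    show "(\<lambda>n. \<Prod>i<n + M. 1 + a i) \<longlonglongrightarrow> L"
      using L by (rule LIMSEQ_ignore_initial_segment)
    have "(\<Prod>i<n + M. 1 + a i) = (\<Prod>i<M. 1 + a i) * (\<Prod>i<n. 1 + a (i + M))" for n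
      by (induction n) (simp_all add: mult_ac)
    then show "(\<lambda>n. \<Prod>i<n + M. 1 + a i) \<longlonglongrightarrow> (\<Prod>i<M. 1 + a i) * L'"
      using L' by (simp add: tendsto_mult)
  qed
  moreover have "(\<Prod>i<M. 1 + a i) dvd 1"
    using prod_dvd_prod[of "{..<M}" "\<lambda>i. 1 + a i" "\<lambda>_. 1"] unit by simp
  ultimately show ?thesis
    using mult_dvd_mono[of "\<Prod>i<M. 1 + a i" 1 L' 1] by simp
qed

lemma one_minus_dvd_one:
  fixes x :: "'a::normed_idom"
  assumes "mag x < 1"
  shows "1 - x dvd 1"
  using assms by (intro dvd_one_if_dist_less) (simp add: dist_eq_mag)

lemma mag_power_less_one: "mag x < 1 \<Longrightarrow> n > 0 \<Longrightarrow> mag (x ^ n) < 1"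
  by (meson le_less_trans mag_nonneg mag_power_le power_less_one_iff)

text \<open>\<open>raw_has_prod\<close> demands a nonzero limit, which holds because the limit is a
  unit. The unit property also justifies dividing by the product later.\<close>

lemma has_prod_one_plus:
  fixes a :: "nat \<Rightarrow> 'a::normed_idom"
  assumes a: "summable (\<lambda>n. mag (a n))" and unit: "\<And>n. 1 + a n dvd 1"
  shows "convergent_prod (\<lambda>n. 1 + a n)"
    and "(\<lambda>n. \<Prod>i<n. 1 + a i) \<longlonglongrightarrow> (\<Prod>n. 1 + a n)"
    and "(\<Prod>n. 1 + a n) dvd 1"
proof -
  obtain L where L: "(\<lambda>n. \<Prod>i<n. 1 + a i) \<longlonglongrightarrow> L"
    using convergent_prod_one_plus[OF a] by (auto simp: convergent_def)
  have "L dvd 1"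
    using a unit L by (rule tendsto_prod_one_plus_unit)
  then have raw: "raw_has_prod (\<lambda>n. 1 + a n) 0 L"
    using L by (auto simp: raw_has_prod_def LIMSEQ_lessThan_iff_atMost)
  then have "(\<Prod>n. 1 + a n) = L"
    by (intro has_prod_unique[symmetric]) (simp add: has_prod_def)
  with L \<open>L dvd 1\<close> show "(\<lambda>n. \<Prod>i<n. 1 + a i) \<longlonglongrightarrow> (\<Prod>n. 1 + a n)" "(\<Prod>n. 1 + a n) dvd 1"
    by simp_all
  show "convergent_prod (\<lambda>n. 1 + a n)"
    using raw by (auto simp: convergent_prod_def)
qed

section \<open>Finite and infinite q-Pochhammer products\<close>

lemma mag_power_mult_le:
  assumes "mag z \<le> 1"
  shows "mag (q ^ j * z) \<le> mag q ^ j"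
proof -
  have "mag (q ^ j * z) \<le> mag q ^ j * 1"
    using assms by (intro order_trans[OF mag_mult_le] mult_mono mag_power_le) auto
  then show ?thesis by simp
qed

lemma one_minus_power_mult_dvd_one:
  fixes q z :: "'a::normed_idom"
  assumes "mag q < 1" "mag z < 1"
  shows "1 - q ^ j * z dvd 1"
proof (rule one_minus_dvd_one)
  have "mag (q ^ j * z) \<le> mag q ^ j * mag z"
    by (intro order_trans[OF mag_mult_le] mult_right_mono mag_power_le) auto
  also have "\<dots> \<le> 1 * mag z"
    using assms by (intro mult_right_mono power_le_one) auto
  finally show "mag (q ^ j * z) < 1"
    using assms by simp
qed

lemma qpoch_dvd_one:
  fixes q z :: "'a::normed_idom"
  assumes "mag q < 1" "mag z < 1"
  shows "qpoch z q n dvd 1"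
  using prod_dvd_prod[of "{..<n}" "\<lambda>j. 1 - q ^ j * z" "\<lambda>_. 1"] one_minus_power_mult_dvd_one[OF assms]
  by (simp add: qpoch_def)

lemma qpoch_inf_converges:
  fixes q z :: "'a::normed_idom"
  assumes "mag q < 1" "mag z < 1"
  shows "convergent_prod (\<lambda>j. 1 - q ^ j * z)"
    and "qpoch z q \<longlonglongrightarrow> qpoch_inf z q"
    and "qpoch_inf z q dvd 1"
proof -
  have "summable (\<lambda>j. mag (- (q ^ j * z)))"
  proof (rule summable_comparison_test[OF _ summable_geometric])
    show "norm (mag q) < 1"
      using assms by simp
    show "\<exists>N. \<forall>j\<ge>N. norm (mag (- (q ^ j * z))) \<le> mag q ^ j"
      using mag_power_mult_le[of z q] assms by simp
  qed
  from has_prod_one_plus[OF this] one_minus_power_mult_dvd_one[OF assms]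
  show "convergent_prod (\<lambda>j. 1 - q ^ j * z)" "qpoch z q \<longlonglongrightarrow> qpoch_inf z q" "qpoch_inf z q dvd 1"
    by (simp_all add: qpoch_def [abs_def] qpoch_inf_def)
qed

lemma mag_square_less_one: "mag q < 1 \<Longrightarrow> mag (q\<^sup>2) < 1"
  by (rule mag_power_less_one) simp_all

text \<open>Difference of squares in each factor,
  \<open>1 - q ^ (2 * j + 2) = (1 - q ^ Suc j) * (1 + q ^ Suc j)\<close>, already for the finite
  products.\<close>

lemma qpoch_inf_square:
  fixes q :: "'a::normed_idom"
  assumes "mag q < 1"
  shows "qpoch_inf (q\<^sup>2) (q\<^sup>2) = qpoch_inf q q * qpoch_inf (- q) q"
proof (rule LIMSEQ_unique)
  show "qpoch (q\<^sup>2) (q\<^sup>2) \<longlonglongrightarrow> qpoch_inf (q\<^sup>2) (q\<^sup>2)"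
    using assms by (intro qpoch_inf_converges mag_square_less_one)
  have "qpoch (q\<^sup>2) (q\<^sup>2) = (\<lambda>n. qpoch q q n * qpoch (- q) q n)"
    unfolding qpoch_def prod.distrib[symmetric]
    by (intro ext prod.cong refl) (simp add: algebra_simps power2_eq_square power_mult_distrib)
  then show "qpoch (q\<^sup>2) (q\<^sup>2) \<longlonglongrightarrow> qpoch_inf q q * qpoch_inf (- q) q"
    using assms by (simp add: tendsto_mult qpoch_inf_converges)
qed

section \<open>Euler's series and the sum over \<open>n\<close>\<close>

text \<open>The coefficient of \<open>z ^ n\<close> in Euler's expansion of the product of all
  \<open>1 + q ^ j * z\<close>. For \<open>mag q < 1\<close> the divisor is a unit, so the division
  is exact.\<close>

definition euler_coeff :: "'a::idom_divide \<Rightarrow> nat \<Rightarrow> 'a" where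
  "euler_coeff q n = q ^ (n choose 2) div qpoch q q n"

lemma euler_coeff_0 [simp]: "euler_coeff q 0 = 1"
  using nonzero_mult_div_cancel_left[of 1 "1::'a"]
  by (simp add: euler_coeff_def qpoch_def binomial_eq_0)

lemma div_unit_mult:
  fixes x u :: "'a::idom_divide"
  assumes "u dvd 1"
  shows "x div u * u = x"
proof -
  obtain v where v: "1 = u * v"
    using assms by (auto elim: dvdE)
  then have "x = u * (v * x)" "u \<noteq> 0"
    by (auto simp: mult.assoc[symmetric])
  then show ?thesis
    by (metis mult.commute nonzero_mult_div_cancel_left)
qed

text \<open>The coefficient of \<open>z ^ Suc n\<close> in \<open>F z = (1 + z) * F (q * z)\<close>.
  It rests on \<open>Suc n choose 2 = n + (n choose 2)\<close>; both sides are multiplied by the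
  unit \<open>qpoch q q n\<close>, which is cancelled at the end.\<close>

lemma euler_coeff_Suc:
  fixes q :: "'a::normed_idom"
  assumes q: "mag q < 1"
  shows "(1 - q ^ Suc n) * euler_coeff q (Suc n) = q ^ n * euler_coeff q n"
proof -
  have unit: "qpoch q q k dvd 1" for k
    using qpoch_dvd_one[OF q q] .
  have mult: "euler_coeff q k * qpoch q q k = q ^ (k choose 2)" for k
    unfolding euler_coeff_def by (rule div_unit_mult[OF unit])
  have "((1 - q ^ Suc n) * euler_coeff q (Suc n)) * qpoch q q n
      = euler_coeff q (Suc n) * qpoch q q (Suc n)"
    by (simp add: qpoch_def mult_ac)
  also have "\<dots> = q ^ n * q ^ (n choose 2)"
    unfolding mult by (simp add: power_add numeral_2_eq_2)
  also have "\<dots> = (q ^ n * euler_coeff q n) * qpoch q q n"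
    by (simp add: mult[symmetric] mult_ac)
  finally show ?thesis
    using unit[of n] by auto
qed

text \<open>Submultiplicativity gives no upper bound for the inverse of a unit. So the recurrence is
  solved for \<open>euler_coeff q (Suc n)\<close> with an error term in the same quantity, which is
  absorbed on the left since \<open>mag q ^ Suc n \<le> mag q\<close>.\<close>

lemma mag_euler_coeff_Suc_le:
  fixes q :: "'a::normed_idom"
  assumes q: "mag q < 1"
  shows "mag (euler_coeff q (Suc n)) \<le> mag q ^ n / (1 - mag q) * mag (euler_coeff q n)"
proof -
  let ?e = "euler_coeff q"
  have "?e (Suc n) = q ^ n * ?e n + q ^ Suc n * ?e (Suc n)"
    using euler_coeff_Suc[OF q, of n] by (simp add: algebra_simps)
  then have "mag (?e (Suc n)) \<le> mag (q ^ n * ?e n) + mag (q ^ Suc n * ?e (Suc n))"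
    by (metis mag_add_le)
  also have "\<dots> \<le> mag q ^ n * mag (?e n) + mag q ^ Suc n * mag (?e (Suc n))"
    by (intro add_mono order_trans[OF mag_mult_le] mult_right_mono mag_power_le) auto
  also have "\<dots> \<le> mag q ^ n * mag (?e n) + mag q * mag (?e (Suc n))"
    using q power_decreasing[of 1 "Suc n" "mag q"]
    by (intro add_mono mult_right_mono) auto
  finally show ?thesis
    using q by (simp add: field_simps)
qed

lemma summable_mag_euler_coeff:
  fixes q :: "'a::normed_idom"
  assumes q: "mag q < 1"
  shows "summable (\<lambda>n. mag (euler_coeff q n))"
proof -
  \<comment> \<open>The growth factor in \<open>mag_euler_coeff_Suc_le\<close> tends to 0, so the
    ratio test applies with 1/2.\<close>
  have "(\<lambda>n. mag q ^ n / (1 - mag q)) \<longlonglongrightarrow> 0 / (1 - mag q)"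
    using q by (intro tendsto_intros LIMSEQ_realpow_zero) auto
  then have "\<forall>\<^sub>F n in sequentially. mag q ^ n / (1 - mag q) < 1 / 2"
    by (intro order_tendstoD) auto
  then obtain N where N: "\<And>n. n \<ge> N \<Longrightarrow> mag q ^ n / (1 - mag q) < 1 / 2"
    by (auto simp: eventually_sequentially)
  show ?thesis
  proof (rule summable_ratio_test)
    fix n
    assume "N \<le> n"
    then have "mag q ^ n / (1 - mag q) * mag (euler_coeff q n) \<le> 1 / 2 * mag (euler_coeff q n)"
      using N[of n] by (intro mult_right_mono) auto
    with mag_euler_coeff_Suc_le[OF q, of n]
    have "mag (euler_coeff q (Suc n)) \<le> 1 / 2 * mag (euler_coeff q n)"
      by (rule order_trans)
    then show "norm (mag (euler_coeff q (Suc n))) \<le> 1 / 2 * norm (mag (euler_coeff q n))"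
      by simp
  qed simp
qed

lemma summable_mag_even_euler_coeff:
  fixes q :: "'a::normed_idom"
  assumes q: "mag q < 1"
  shows "summable (\<lambda>n. mag (euler_coeff q (2 * n)))"
  using summable_reindex[OF summable_mag_euler_coeff[OF q], of "\<lambda>n. 2 * n"]
  by (simp add: inj_on_def comp_def)

lemma mag_power_le_one: "mag z \<le> 1 \<Longrightarrow> mag (z ^ n) \<le> 1"
  by (meson mag_nonneg mag_power_le order_trans power_le_one)

lemma mag_mult_le_left: "mag z \<le> 1 \<Longrightarrow> mag (x * z) \<le> mag x"
  using mag_mult_le[of x z] mult_left_le[of "mag z" "mag x"] by simp

lemma convergent_sum_if_summable_mag:
  fixes f :: "nat \<Rightarrow> 'a::normed_idom"
  assumes "summable (\<lambda>n. mag (f n))"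
  shows "convergent (\<lambda>M. \<Sum>n<M. f n)"
  by (rule Cauchy_convergent, rule Cauchy_if_summable_dist[OF assms])
     (simp add: dist_commute dist_eq_mag)

text \<open>The function \<open>F\<close> of the introduction. The limit exists for
  \<open>mag z \<le> 1\<close>, in particular at the two points \<open>1\<close> and
  \<open>- 1\<close> where it is evaluated.\<close>

definition euler_sum :: "'a::normed_idom \<Rightarrow> 'a \<Rightarrow> 'a" where
  "euler_sum q z = lim (\<lambda>M. \<Sum>n<M. euler_coeff q n * z ^ n)"

lemma tendsto_euler_sum:
  fixes q z :: "'a::normed_idom"
  assumes "mag q < 1" "mag z \<le> 1"
  shows "(\<lambda>M. \<Sum>n<M. euler_coeff q n * z ^ n) \<longlonglongrightarrow> euler_sum q z"
  unfolding euler_sum_def convergent_LIMSEQ_iff[symmetric]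
proof (rule convergent_sum_if_summable_mag)
  show "summable (\<lambda>n. mag (euler_coeff q n * z ^ n))"
    by (rule summable_comparison_test[OF _ summable_mag_euler_coeff[OF assms(1)]])
       (use assms in \<open>auto intro!: mag_mult_le_left mag_power_le_one\<close>)
qed

text \<open>\<open>F z = (1 + z) * F (q * z)\<close> for truncated series. The correction is the
  term in \<open>z ^ Suc M\<close> that multiplication by \<open>1 + z\<close> creates beyond the
  truncation.\<close>

lemma euler_sum_partial:
  fixes q z :: "'a::normed_idom"
  assumes q: "mag q < 1"
  shows "(\<Sum>n<Suc M. euler_coeff q n * z ^ n)
    = (1 + z) * (\<Sum>n<Suc M. euler_coeff q n * (q * z) ^ n) - euler_coeff q M * (q ^ M * z ^ Suc M)"
proof (induction M)
  case (Suc M)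
  let ?e = "euler_coeff q"
  have "q ^ M * ?e M = ?e (Suc M) - q ^ Suc M * ?e (Suc M)"
    using euler_coeff_Suc[OF q, of M] by (simp add: algebra_simps)
  then have *: "?e M * (q ^ M * z ^ Suc M) = (?e (Suc M) - q ^ Suc M * ?e (Suc M)) * z ^ Suc M"
    by (metis mult.assoc mult.commute)
  show ?case
    unfolding sum.lessThan_Suc[of _ "Suc M"] Suc.IH *
    by (simp add: algebra_simps power_mult_distrib)
qed simp

lemma euler_sum_step:
  fixes q z :: "'a::normed_idom"
  assumes q: "mag q < 1" and z: "mag z \<le> 1"
  shows "euler_sum q z = (1 + z) * euler_sum q (q * z)"
proof (rule LIMSEQ_unique)
  show "(\<lambda>M. \<Sum>n<Suc M. euler_coeff q n * z ^ n) \<longlonglongrightarrow> euler_sum q z"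
    using tendsto_euler_sum[OF q z] by (rule LIMSEQ_Suc)
  have qz: "mag (q * z) \<le> 1"
    using q mag_mult_le_left[OF z, of q] by simp
  have "(\<lambda>M. euler_coeff q M * (q ^ M * z ^ Suc M)) \<longlonglongrightarrow> 0"
    unfolding tendsto_normed_idom_iff
  proof (rule tendsto_sandwich[OF _ _ tendsto_const])
    show "(\<lambda>M. mag (euler_coeff q M)) \<longlonglongrightarrow> 0"
      using summable_mag_euler_coeff[OF q] by (rule summable_LIMSEQ_zero)
    show "\<forall>\<^sub>F M in sequentially. mag (euler_coeff q M * (q ^ M * z ^ Suc M) - 0) \<le> mag (euler_coeff q M)"
    proof (intro always_eventually allI)
      fix M
      have "mag (q ^ M * z ^ Suc M) \<le> 1"
        using q z by (meson less_imp_le mag_mult_le_left mag_power_le_one order_trans)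
      then show "mag (euler_coeff q M * (q ^ M * z ^ Suc M) - 0) \<le> mag (euler_coeff q M)"
        by (simp only: diff_0_right mag_mult_le_left)
    qed
  qed auto
  then have "(\<lambda>M. (1 + z) * (\<Sum>n<Suc M. euler_coeff q n * (q * z) ^ n)
      - euler_coeff q M * (q ^ M * z ^ Suc M)) \<longlonglongrightarrow> (1 + z) * euler_sum q (q * z) - 0"
    by (intro tendsto_intros LIMSEQ_Suc[OF tendsto_euler_sum[OF q qz]])
  then show "(\<lambda>M. \<Sum>n<Suc M. euler_coeff q n * z ^ n) \<longlonglongrightarrow> (1 + z) * euler_sum q (q * z)"
    unfolding euler_sum_partial[OF q, where z = z, symmetric] by simp
qed

lemma euler_sum_qpoch:
  fixes q z :: "'a::normed_idom"
  assumes q: "mag q < 1" and z: "mag z \<le> 1"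
  shows "euler_sum q z = qpoch (- z) q N * euler_sum q (q ^ N * z)"
proof (induction N)
  case (Suc N)
  have "mag (q ^ N * z) \<le> 1"
    using q z by (meson less_imp_le mag_mult_le_left mag_power_le_one order_trans)
  from euler_sum_step[OF q this] Suc show ?case
    by (simp add: qpoch_def mult_ac)
qed (simp add: qpoch_def)

text \<open>Every term but the first contains a factor \<open>z\<close>. The bound yields
  \<open>F (q ^ Suc N) \<longlonglongrightarrow> 1\<close>, the end of the iteration of the
  functional equation.\<close>

lemma mag_euler_sum_diff_one_le:
  fixes q z :: "'a::normed_idom"
  assumes q: "mag q < 1" and z: "mag z \<le> 1"
  shows "mag (euler_sum q z - 1) \<le> (\<Sum>n. mag (euler_coeff q n)) * mag z"
proof -
  let ?C = "\<Sum>n. mag (euler_coeff q n)"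
  have "dist (\<Sum>n<Suc M. euler_coeff q n * z ^ n) 1 \<le> ?C * mag z" for M
  proof -
    have "dist (\<Sum>n<Suc M. euler_coeff q n * z ^ n) 1 = mag (\<Sum>n<M. euler_coeff q (Suc n) * z ^ Suc n)"
      unfolding dist_eq_mag sum.lessThan_Suc_shift by simp
    also have "\<dots> \<le> (\<Sum>n<M. mag (euler_coeff q (Suc n) * z ^ Suc n))"
      by (rule mag_sum_le)
    also have "\<dots> \<le> (\<Sum>n<M. mag (euler_coeff q (Suc n)) * mag z)"
    proof (rule sum_mono)
      fix n
      have "mag (z ^ Suc n) \<le> mag z"
        using mag_mult_le_left[OF mag_power_le_one[OF z], of z n] by simp
      then show "mag (euler_coeff q (Suc n) * z ^ Suc n) \<le> mag (euler_coeff q (Suc n)) * mag z"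
        by (intro order_trans[OF mag_mult_le] mult_left_mono) auto
    qed
    also have "\<dots> = (\<Sum>n<M. mag (euler_coeff q (Suc n))) * mag z"
      by (simp add: sum_distrib_right)
    also have "\<dots> \<le> (\<Sum>n<Suc M. mag (euler_coeff q n)) * mag z"
      unfolding sum.lessThan_Suc_shift by (intro mult_right_mono) auto
    also have "\<dots> \<le> ?C * mag z"
      using summable_mag_euler_coeff[OF q] by (intro mult_right_mono sum_le_suminf) auto
    finally show ?thesis .
  qed
  then have "dist (euler_sum q z) 1 \<le> ?C * mag z"
    by (intro LIMSEQ_le_const2[OF tendsto_dist[OF LIMSEQ_Suc[OF tendsto_euler_sum[OF q z]] tendsto_const]])
       blast
  then show ?thesis
    by (simp add: dist_eq_mag)
qed

lemma euler_sum_one: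
  fixes q :: "'a::normed_idom"
  assumes q: "mag q < 1"
  shows "euler_sum q 1 = 2 * qpoch_inf (- q) q"
proof -
  have "(\<lambda>N. euler_sum q (q ^ Suc N)) \<longlonglongrightarrow> 1"
    unfolding tendsto_normed_idom_iff
  proof (rule tendsto_sandwich[OF _ _ tendsto_const])
    have "(\<lambda>N. (\<Sum>n. mag (euler_coeff q n)) * mag q ^ Suc N) \<longlonglongrightarrow> (\<Sum>n. mag (euler_coeff q n)) * 0"
      using q by (intro tendsto_intros LIMSEQ_Suc LIMSEQ_realpow_zero) auto
    then show "(\<lambda>N. (\<Sum>n. mag (euler_coeff q n)) * mag q ^ Suc N) \<longlonglongrightarrow> 0"
      by simp
    have "mag (euler_sum q (q ^ Suc N) - 1) \<le> (\<Sum>n. mag (euler_coeff q n)) * mag q ^ Suc N" for N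
    proof -
      have "mag (euler_sum q (q ^ Suc N) - 1) \<le> (\<Sum>n. mag (euler_coeff q n)) * mag (q ^ Suc N)"
        using q by (intro mag_euler_sum_diff_one_le mag_power_le_one) auto
      also have "\<dots> \<le> (\<Sum>n. mag (euler_coeff q n)) * mag q ^ Suc N"
        by (intro mult_left_mono mag_power_le suminf_nonneg summable_mag_euler_coeff q) auto
      finally show ?thesis .
    qed
    then show "\<forall>\<^sub>F N in sequentially.
        mag (euler_sum q (q ^ Suc N) - 1) \<le> (\<Sum>n. mag (euler_coeff q n)) * mag q ^ Suc N"
      by simp
  qed auto
  then have "(\<lambda>N. 2 * qpoch (- q) q N * euler_sum q (q ^ Suc N)) \<longlonglongrightarrow> 2 * qpoch_inf (- q) q * 1"
    using q by (intro tendsto_intros qpoch_inf_converges) auto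
  moreover have "2 * qpoch (- q) q N * euler_sum q (q ^ Suc N) = euler_sum q 1" for N
  proof -
    \<comment> \<open>The factor \<open>j = 0\<close> is \<open>1 + 1\<close>. It is split off
      because \<open>qpoch_inf_converges\<close> asks for \<open>mag z < 1\<close>, which holds for
      \<open>- q\<close> but not for \<open>- 1\<close>.\<close>
    have "qpoch (- 1) q (Suc N) = 2 * qpoch (- q) q N"
      unfolding qpoch_def prod.lessThan_Suc_shift by (simp add: mult.commute)
    then show ?thesis
      using euler_sum_qpoch[OF q, of 1 "Suc N"] by simp
  qed
  ultimately show ?thesis
    by (simp add: LIMSEQ_const_iff)
qed

text \<open>The factor \<open>1 + z\<close> of the functional equation vanishes here.\<close>

lemma euler_sum_minus_one:
  fixes q :: "'a::normed_idom"
  assumes q: "mag q < 1"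
  shows "euler_sum q (- 1) = 0"
  using euler_sum_step[OF q, of "- 1"] by simp

lemma tendsto_sum_even_euler_coeff:
  fixes q :: "'a::normed_idom"
  assumes q: "mag q < 1"
  shows "(\<lambda>M. \<Sum>n<M. euler_coeff q (2 * n)) \<longlonglongrightarrow> qpoch_inf (- q) q"
proof -
  \<comment> \<open>The limit \<open>S\<close> is secured first: in this class 2 can be cancelled
    from \<open>2 * S\<close> but need not be invertible.\<close>
  from convergent_sum_if_summable_mag[OF summable_mag_even_euler_coeff[OF q]]
  obtain S where S: "(\<lambda>M. \<Sum>n<M. euler_coeff q (2 * n)) \<longlonglongrightarrow> S"
    by (auto simp: convergent_def)
  have double: "filterlim (\<lambda>M::nat. 2 * M) sequentially sequentially"
    by (intro filterlim_subseq strict_monoI) simp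
  \<comment> \<open>Truncating at the even bound \<open>2 * M\<close> keeps the parities paired: odd
    terms cancel and even ones double.\<close>
  have "(\<lambda>M. (\<Sum>n<2 * M. euler_coeff q n * 1 ^ n) + (\<Sum>n<2 * M. euler_coeff q n * (- 1) ^ n))
      \<longlonglongrightarrow> euler_sum q 1 + euler_sum q (- 1)"
    by (intro tendsto_add filterlim_compose[OF tendsto_euler_sum[OF q] double]) simp_all
  moreover have "(\<Sum>n<2 * M. euler_coeff q n * 1 ^ n) + (\<Sum>n<2 * M. euler_coeff q n * (- 1) ^ n)
      = 2 * (\<Sum>n<M. euler_coeff q (2 * n))" for M
    by (induction M) (simp_all add: algebra_simps)
  ultimately have "(\<lambda>M. 2 * (\<Sum>n<M. euler_coeff q (2 * n))) \<longlonglongrightarrow> 2 * qpoch_inf (- q) q"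
    by (simp add: euler_sum_one[OF q] euler_sum_minus_one[OF q])
  moreover have "(\<lambda>M. 2 * (\<Sum>n<M. euler_coeff q (2 * n))) \<longlonglongrightarrow> 2 * S"
    by (intro tendsto_intros S)
  ultimately have "2 * S = 2 * qpoch_inf (- q) q"
    by (rule LIMSEQ_unique[rotated])
  then show ?thesis
    using S by simp
qed

section \<open>Shanks's identity and the pentagonal number theorem\<close>

text \<open>The summand is the difference between the terms of Shanks's sums (\<open>shanks_identity\<close> below)
  for \<open>N + 1\<close> and \<open>N\<close>.\<close>

lemma shanks_telescope:
  fixes p :: "'a::comm_ring_1"
  assumes "m \<le> N"
  shows "(\<Sum>s\<le>m. (- 1) ^ s * (\<Prod>j=s..<N. 1 - p ^ Suc j) *
      (p ^ (s * Suc N + (Suc s choose 2)) * (1 - p ^ Suc N) - p ^ (s * N + (Suc s choose 2))))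
    = - ((- 1) ^ m * (\<Prod>j=m..<N. 1 - p ^ Suc j) * p ^ (Suc m * Suc N + (Suc m choose 2)))"
  using assms
proof (induction m)
  case 0
  then show ?case
    by (simp add: algebra_simps power_add binomial_eq_0)
next
  case (Suc m)
  let ?P = "\<Prod>j=Suc m..<N. 1 - p ^ Suc j"
  have P: "(\<Prod>j=m..<N. 1 - p ^ Suc j) = (1 - p ^ Suc m) * ?P"
    using Suc.prems by (simp add: prod.atLeast_Suc_lessThan)
  have choose: "Suc (Suc m) choose 2 = Suc m + (Suc m choose 2)"
    by (simp add: numeral_2_eq_2)
  have e: "p ^ (Suc m * N + (Suc (Suc m) choose 2)) = p ^ (Suc m * Suc N + (Suc m choose 2))"
    "p ^ (Suc m * Suc N + (Suc (Suc m) choose 2)) = p ^ Suc m * p ^ (Suc m * Suc N + (Suc m choose 2))"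
    "p ^ (Suc (Suc m) * Suc N + (Suc (Suc m) choose 2))
      = p ^ Suc N * p ^ Suc m * p ^ (Suc m * Suc N + (Suc m choose 2))"
    unfolding power_add[symmetric] choose
    by (rule arg_cong[of _ _ "\<lambda>k. p ^ k"], simp)+
  have IH: "(\<Sum>s\<le>m. (- 1) ^ s * (\<Prod>j=s..<N. 1 - p ^ Suc j) *
      (p ^ (s * Suc N + (Suc s choose 2)) * (1 - p ^ Suc N) - p ^ (s * N + (Suc s choose 2))))
    = - ((- 1) ^ m * ((1 - p ^ Suc m) * ?P) * p ^ (Suc m * Suc N + (Suc m choose 2)))"
    using Suc P by simp
  \<comment> \<open>The induction step with \<open>a\<close> for \<open>p ^ Suc m\<close>,
    \<open>b\<close> for \<open>p ^ Suc N\<close>, \<open>u\<close> for \<open>?P\<close>,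
    \<open>t\<close> for the sign and \<open>c\<close> for the power of \<open>p\<close> common to
    all terms in \<open>e\<close>.\<close>
  have "- (t * ((1 - a) * u) * c) + (- 1 * t) * u * (a * c * (1 - b) - c)
      = - ((- 1 * t) * u * (b * a * c))" for t a b c u :: 'a
    by (simp add: algebra_simps)
  then show ?case
    unfolding sum.atMost_Suc e power_Suc[of "- 1"] IH .
qed

text \<open>Passing from \<open>N\<close> to \<open>Suc N\<close>, the terms with
  \<open>s \<le> N\<close> change by one new power of \<open>p\<close> in total, by telescoping; the
  added term \<open>s = Suc N\<close> has an empty product and is the other new power.\<close>

lemma shanks_identity:
  fixes p :: "'a::comm_ring_1"
  shows "(\<Sum>s\<le>n. (- 1) ^ s * (\<Prod>j=s..<n. 1 - p ^ Suc j) * p ^ (s * n + (Suc s choose 2)))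
    = 1 + (\<Sum>k=1..n. (- 1) ^ k * (p ^ (k * k + (k choose 2)) + p ^ (k * k + (Suc k choose 2))))"
proof (induction n)
  case (Suc N)
  let ?t = "\<lambda>n s. (- 1) ^ s * (\<Prod>j=s..<n. 1 - p ^ Suc j) * p ^ (s * n + (Suc s choose 2))"
  have "(\<Sum>s\<le>N. ?t (Suc N) s) - (\<Sum>s\<le>N. ?t N s)
    = (\<Sum>s\<le>N. (- 1) ^ s * (\<Prod>j=s..<N. 1 - p ^ Suc j) *
      (p ^ (s * Suc N + (Suc s choose 2)) * (1 - p ^ Suc N) - p ^ (s * N + (Suc s choose 2))))"
    unfolding sum_subtractf[symmetric]
    by (intro sum.cong refl) (simp add: algebra_simps)
  also have "\<dots> = (- 1) ^ Suc N * p ^ (Suc N * Suc N + (Suc N choose 2))"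
    by (subst shanks_telescope) simp_all
  finally show ?case
    using Suc by (simp add: algebra_simps)
qed (simp add: binomial_eq_0)

text \<open>In Shanks's identity the term \<open>s = 0\<close> is \<open>qpoch p p n\<close>. Each
  of the other \<open>n\<close> terms has exponent at least \<open>n\<close> and a product bounded
  independently of \<open>s\<close> and \<open>n\<close>, so together they are at most
  \<open>E * n * mag p ^ n\<close>.\<close>

lemma tendsto_pentagonal:
  fixes p :: "'a::normed_idom"
  assumes p: "mag p < 1"
  shows "(\<lambda>n. 1 + (\<Sum>k=1..n. (- 1) ^ k * (p ^ (k * k + (k choose 2)) + p ^ (k * k + (Suc k choose 2)))))
    \<longlonglongrightarrow> qpoch_inf p p"
proof -
  define t where "t n s = (- 1) ^ s * (\<Prod>j=s..<n. 1 - p ^ Suc j) * p ^ (s * n + (Suc s choose 2))"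
    for n s
  define E where "E = exp (\<Sum>j. mag p ^ Suc j)"
  have t_le: "mag (t n s) \<le> E * mag p ^ n" if "1 \<le> s" for n s
  proof -
    have sm: "summable (\<lambda>j. mag p ^ Suc j)"
      using p by (intro summable_Suc_iff[THEN iffD2] summable_geometric) simp
    have "mag (\<Prod>j=s..<n. 1 + - (p ^ Suc j)) \<le> exp (\<Sum>j=s..<n. mag (- (p ^ Suc j)))"
      by (rule mag_prod_one_plus_le)
    also have "(\<Sum>j=s..<n. mag (- (p ^ Suc j))) \<le> (\<Sum>j=s..<n. mag p ^ Suc j)"
      unfolding mag_minus by (intro sum_mono mag_power_le)
    also have "\<dots> \<le> (\<Sum>j. mag p ^ Suc j)"
      by (intro sum_le_suminf sm) auto
    finally have prod_le: "mag (\<Prod>j=s..<n. 1 - p ^ Suc j) \<le> E"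
      by (simp add: E_def)
    have "n \<le> s * n + (Suc s choose 2)"
      using that by (simp add: trans_le_add1)
    then have "mag (p ^ (s * n + (Suc s choose 2))) \<le> mag p ^ n"
      using p by (intro order_trans[OF mag_power_le] power_decreasing) auto
    with prod_le have "mag ((\<Prod>j=s..<n. 1 - p ^ Suc j) * p ^ (s * n + (Suc s choose 2))) \<le> E * mag p ^ n"
      by (intro order_trans[OF mag_mult_le] mult_mono) (auto simp: E_def)
    moreover have "mag (t n s)
        \<le> mag ((- 1 :: 'a) ^ s) * mag ((\<Prod>j=s..<n. 1 - p ^ Suc j) * p ^ (s * n + (Suc s choose 2)))"
      unfolding t_def mult.assoc by (rule mag_mult_le)
    ultimately show ?thesis
      by simp
  qed
  have "(\<lambda>n. \<Sum>s=1..n. t n s) \<longlonglongrightarrow> 0"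
    unfolding tendsto_normed_idom_iff
  proof (rule tendsto_sandwich[OF _ _ tendsto_const])
    have "(\<lambda>n. E * (real n * mag p ^ n)) \<longlonglongrightarrow> E * 0"
      using p by (intro tendsto_mult tendsto_const powser_times_n_limit_0) simp
    then show "(\<lambda>n. E * (real n * mag p ^ n)) \<longlonglongrightarrow> 0"
      by simp
    have "mag (\<Sum>s=1..n. t n s) \<le> E * (real n * mag p ^ n)" for n
    proof -
      have "mag (\<Sum>s=1..n. t n s) \<le> (\<Sum>s=1..n. E * mag p ^ n)"
        by (intro order_trans[OF mag_sum_le] sum_mono t_le) simp
      then show ?thesis by (simp add: mult_ac)
    qed
    then show "\<forall>\<^sub>F n in sequentially. mag ((\<Sum>s=1..n. t n s) - 0) \<le> E * (real n * mag p ^ n)"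
      by simp
  qed auto
  then have "(\<lambda>n. qpoch p p n + (\<Sum>s=1..n. t n s)) \<longlonglongrightarrow> qpoch_inf p p + 0"
    by (intro tendsto_add qpoch_inf_converges p)
  moreover have "qpoch p p n + (\<Sum>s=1..n. t n s) = (\<Sum>s\<le>n. t n s)" for n
  proof -
    have "{..n} = insert 0 {1..n}"
      by auto
    then show ?thesis
      by (simp add: t_def qpoch_def binomial_eq_0 atLeast0LessThan mult.commute)
  qed
  ultimately show ?thesis
    unfolding shanks_identity[of p, symmetric] t_def by simp
qed

section \<open>The sum over all integers\<close>

text \<open>Matches the exponents at \<open>k\<close> and \<open>- k\<close> with the two powers in
  Shanks's identity for \<open>p = q\<^sup>2\<close>.\<close>

lemma pentagonal_exponent:
  shows "nat (3 * (int k)\<^sup>2 - int k) = 2 * (k * k + (k choose 2))"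
    and "nat (3 * (int k)\<^sup>2 + int k) = 2 * (k * k + (Suc k choose 2))"
proof -
  have "2 * int (k choose 2) = int k * (int k - 1)"
    by (induction k) (auto simp: numeral_2_eq_2 algebra_simps)
  then have "3 * (int k)\<^sup>2 - int k = int (2 * (k * k + (k choose 2)))"
    and "3 * (int k)\<^sup>2 + int k = int (2 * (k * k + (Suc k choose 2)))"
    by (simp_all add: numeral_2_eq_2 algebra_simps)
  then show "nat (3 * (int k)\<^sup>2 - int k) = 2 * (k * k + (k choose 2))"
    and "nat (3 * (int k)\<^sup>2 + int k) = 2 * (k * k + (Suc k choose 2))"
    by (simp_all only: nat_int)
qed

lemma sum_symmetric_pentagonal:
  fixes q :: "'a::comm_ring_1"
  shows "(\<Sum>k\<in>{- int n..int n}. (- 1) ^ nat \<bar>k\<bar> * q ^ nat (3 * k\<^sup>2 - k))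
    = 1 + (\<Sum>k=1..n. (- 1) ^ k
        * ((q\<^sup>2) ^ (k * k + (k choose 2)) + (q\<^sup>2) ^ (k * k + (Suc k choose 2))))"
proof (induction n)
  case (Suc n)
  let ?f = "\<lambda>k::int. (- 1) ^ nat \<bar>k\<bar> * q ^ nat (3 * k\<^sup>2 - k)" and ?k = "Suc n"
  have "{- int ?k..int ?k} = insert (int ?k) (insert (- int ?k) {- int n..int n})"
    by auto
  then have "(\<Sum>k\<in>{- int ?k..int ?k}. ?f k) = ?f (int ?k) + (?f (- int ?k) + (\<Sum>k\<in>{- int n..int n}. ?f k))"
    by simp
  moreover have "?f (int ?k) = (- 1) ^ ?k * (q\<^sup>2) ^ (?k * ?k + (?k choose 2))"
    by (simp only: pentagonal_exponent power_mult abs_of_nat nat_int)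
  moreover have "?f (- int ?k) = (- 1) ^ ?k * (q\<^sup>2) ^ (?k * ?k + (Suc ?k choose 2))"
    by (simp only: pentagonal_exponent power_mult abs_minus_cancel abs_of_nat nat_int
        power2_minus diff_minus_eq_add)
  ultimately have "(\<Sum>k\<in>{- int ?k..int ?k}. ?f k)
    = (\<Sum>k\<in>{- int n..int n}. ?f k)
      + (- 1) ^ ?k * ((q\<^sup>2) ^ (?k * ?k + (?k choose 2)) + (q\<^sup>2) ^ (?k * ?k + (Suc ?k choose 2)))"
    by (simp only: distrib_left add_ac)
  then show ?case
    unfolding Suc.IH by simp
qed simp

lemma summable_on_geometric_int:
  fixes r :: real
  assumes "0 \<le> r" "r < 1"
  shows "(\<lambda>k::int. r ^ nat \<bar>k\<bar>) summable_on UNIV"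
proof -
  let ?f = "\<lambda>k::int. r ^ nat \<bar>k\<bar>"
  have geo: "(\<lambda>n. r ^ n) summable_on UNIV" "(\<lambda>n. r ^ Suc n) summable_on UNIV"
    using assms
    by (auto intro!: norm_summable_imp_summable_on summable_geometric summable_mult simp: norm_power)
  have "?f summable_on range int"
    by (subst summable_on_reindex) (use geo in \<open>auto simp: comp_def\<close>)
  moreover have "?f summable_on range (\<lambda>n. - int (Suc n))"
    by (subst summable_on_reindex) (use geo in \<open>auto simp: comp_def inj_on_def nat_add_distrib\<close>)
  ultimately have "?f summable_on (range int \<union> range (\<lambda>n. - int (Suc n)))"
    by (rule summable_on_Un_disjoint) auto
  moreover have "range int \<union> range (\<lambda>n. - int (Suc n)) = UNIV"
  proof (rule UNIV_eq_I[symmetric])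
    show "k \<in> range int \<union> range (\<lambda>n. - int (Suc n))" for k
      by (cases k rule: int_cases) (auto simp del: of_nat_Suc)
  qed
  ultimately show ?thesis by simp
qed

lemma has_sum_pentagonal:
  fixes q :: "'a::normed_idom"
  assumes q: "mag q < 1"
  shows "((\<lambda>k::int. (- 1) ^ nat \<bar>k\<bar> * q ^ nat (3 * k\<^sup>2 - k)) has_sum qpoch_inf (q\<^sup>2) (q\<^sup>2)) UNIV"
proof (rule has_sum_exhaustI)
  show "(\<lambda>k::int. mag q ^ nat \<bar>k\<bar>) summable_on UNIV"
    using q by (intro summable_on_geometric_int) auto
  show "mag ((- 1) ^ nat \<bar>k\<bar> * q ^ nat (3 * k\<^sup>2 - k)) \<le> mag q ^ nat \<bar>k\<bar>" for k :: int
  proof -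
    \<comment> \<open>Hence \<open>3 * k\<^sup>2 - k\<close> is at least
      \<open>3 * \<bar>k\<bar> - \<bar>k\<bar>\<close>, and the terms are dominated by a two-sided
      geometric series.\<close>
    have "\<bar>k\<bar> \<le> k\<^sup>2"
      using mult_left_mono[of 1 "\<bar>k\<bar>" "\<bar>k\<bar>"]
      by (cases "k = 0") (auto simp: power2_eq_square)
    then have "nat \<bar>k\<bar> \<le> nat (3 * k\<^sup>2 - k)"
      by (intro nat_mono) linarith
    then have "mag (q ^ nat (3 * k\<^sup>2 - k)) \<le> mag q ^ nat \<bar>k\<bar>"
      using q by (intro order_trans[OF mag_power_le] power_decreasing) auto
    then show ?thesis
      using mag_mult_le[of "(- 1) ^ nat \<bar>k\<bar>" "q ^ nat (3 * k\<^sup>2 - k)"] by simp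
  qed
  show "incseq (\<lambda>n. {- int n..int n})"
    by (auto simp: incseq_def)
  show "(\<Union>n. {- int n..int n}) = UNIV"
  proof -
    have "k \<in> {- int (nat \<bar>k\<bar>)..int (nat \<bar>k\<bar>)}" for k
      by auto
    then show ?thesis by blast
  qed
  show "(\<lambda>n. \<Sum>k\<in>{- int n..int n}. (- 1) ^ nat \<bar>k\<bar> * q ^ nat (3 * k\<^sup>2 - k))
      \<longlonglongrightarrow> qpoch_inf (q\<^sup>2) (q\<^sup>2)"
    unfolding sum_symmetric_pentagonal using q by (intro tendsto_pentagonal mag_square_less_one)
qed simp

section \<open>Assembling the equalities\<close>

lemma has_sum_even_euler:
  fixes q :: "'a::normed_idom"
  assumes q: "mag q < 1"
  shows "((\<lambda>n. q ^ (2 * n\<^sup>2 - n) div qpoch q q (2 * n)) has_sum qpoch_inf (- q) q) UNIV"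
proof -
  have "(\<lambda>n. mag (euler_coeff q (2 * n))) summable_on UNIV"
    using summable_mag_even_euler_coeff[OF q] by (intro norm_summable_imp_summable_on) simp
  then have "((\<lambda>n. euler_coeff q (2 * n)) has_sum qpoch_inf (- q) q) UNIV"
    by (rule has_sum_exhaustI[where A = lessThan])
       (auto simp: incseq_def tendsto_sum_even_euler_coeff[OF q])
  moreover have "2 * n choose 2 = 2 * n\<^sup>2 - n" for n
    by (simp add: choose_two power2_eq_square algebra_simps)
  ultimately show ?thesis
    by (simp add: euler_coeff_def)
qed

lemma even_euler_sum_eq_products:
  fixes q :: "'a::normed_idom"
  assumes q: "mag q < 1"
  shows "(\<lambda>n::nat. q ^ (2 * n\<^sup>2 - n) div qpoch q q (2 * n)) summable_on UNIV \<and>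
    (\<lambda>k::int. (-1) ^ nat \<bar>k\<bar> * q ^ nat (3 * k\<^sup>2 - k)) summable_on UNIV \<and>
    convergent_prod (\<lambda>j. 1 - q ^ j * q) \<and>
    convergent_prod (\<lambda>j. 1 - (q\<^sup>2) ^ j * q\<^sup>2) \<and>
    convergent_prod (\<lambda>j. 1 - q ^ j * (- q)) \<and>
    (\<Sum>\<^sub>\<infinity>n::nat. q ^ (2 * n\<^sup>2 - n) div qpoch q q (2 * n))
      = 1 div qpoch_inf q q * (\<Sum>\<^sub>\<infinity>k::int. (-1) ^ nat \<bar>k\<bar> * q ^ nat (3 * k\<^sup>2 - k)) \<and>
    1 div qpoch_inf q q * (\<Sum>\<^sub>\<infinity>k::int. (-1) ^ nat \<bar>k\<bar> * q ^ nat (3 * k\<^sup>2 - k))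
      = qpoch_inf (q\<^sup>2) (q\<^sup>2) div qpoch_inf q q \<and>
    qpoch_inf (q\<^sup>2) (q\<^sup>2) div qpoch_inf q q = qpoch_inf (- q) q"
proof -
  have mq: "mag (- q) < 1" "mag (q\<^sup>2) < 1"
    using q by (simp_all add: mag_square_less_one)
  have unit: "qpoch_inf q q dvd 1"
    using q by (intro qpoch_inf_converges)
  then have "qpoch_inf q q \<noteq> 0"
    by auto
  then have "qpoch_inf (q\<^sup>2) (q\<^sup>2) div qpoch_inf q q = qpoch_inf (- q) q"
    unfolding qpoch_inf_square[OF q] by (rule nonzero_mult_div_cancel_left)
  \<comment> \<open>Here nonzero is not enough: \<open>1 div u * u = 1\<close> holds because
    \<open>u\<close> is a unit.\<close>
  moreover have "1 div qpoch_inf q q * qpoch_inf (q\<^sup>2) (q\<^sup>2) = qpoch_inf (- q) q"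
    unfolding qpoch_inf_square[OF q] mult.assoc[symmetric] div_unit_mult[OF unit] by simp
  ultimately show ?thesis
    unfolding infsumI[OF has_sum_even_euler[OF q]] infsumI[OF has_sum_pentagonal[OF q]]
    using has_sum_imp_summable[OF has_sum_even_euler[OF q]]
      has_sum_imp_summable[OF has_sum_pentagonal[OF q]]
      qpoch_inf_converges(1)[OF q q] qpoch_inf_converges(1)[OF mq(2) mq(2)]
      qpoch_inf_converges(1)[OF q mq(1)]
    by presburger
qed

(* No exponent truncates: 2 n^2 - n and 3 k^2 - k are never negative. The sign is written
   (-1)^|k|, which equals (-1)^k, because formal power series admit no integer powers. *)
theorem corollary5p7:
  shows
    "(let q = (fps_X :: 'a::field_char_0 fps) in
        (\<lambda>n::nat. q ^ (2 * n\<^sup>2 - n) / qpoch q q (2 * n)) summable_on UNIV \<and>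
        (\<lambda>k::int. (-1) ^ nat \<bar>k\<bar> * q ^ nat (3 * k\<^sup>2 - k)) summable_on UNIV \<and>
        convergent_prod (\<lambda>j. 1 - q ^ j * q) \<and>
        convergent_prod (\<lambda>j. 1 - (q\<^sup>2) ^ j * q\<^sup>2) \<and>
        convergent_prod (\<lambda>j. 1 - q ^ j * (- q)) \<and>
        (\<Sum>\<^sub>\<infinity>n::nat. q ^ (2 * n\<^sup>2 - n) / qpoch q q (2 * n))
          = 1 / qpoch_inf q q * (\<Sum>\<^sub>\<infinity>k::int. (-1) ^ nat \<bar>k\<bar> * q ^ nat (3 * k\<^sup>2 - k)) \<and>
        1 / qpoch_inf q q * (\<Sum>\<^sub>\<infinity>k::int. (-1) ^ nat \<bar>k\<bar> * q ^ nat (3 * k\<^sup>2 - k))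
          = qpoch_inf (q\<^sup>2) (q\<^sup>2) / qpoch_inf q q \<and>
        qpoch_inf (q\<^sup>2) (q\<^sup>2) / qpoch_inf q q = qpoch_inf (- q) q)
     \<and>
     (\<forall>q::complex. norm q < 1 \<longrightarrow>
        (\<lambda>n::nat. q ^ (2 * n\<^sup>2 - n) / qpoch q q (2 * n)) summable_on UNIV \<and>
        (\<lambda>k::int. (-1) ^ nat \<bar>k\<bar> * q ^ nat (3 * k\<^sup>2 - k)) summable_on UNIV \<and>
        convergent_prod (\<lambda>j. 1 - q ^ j * q) \<and>
        convergent_prod (\<lambda>j. 1 - (q\<^sup>2) ^ j * q\<^sup>2) \<and>
        convergent_prod (\<lambda>j. 1 - q ^ j * (- q)) \<and>
        (\<Sum>\<^sub>\<infinity>n::nat. q ^ (2 * n\<^sup>2 - n) / qpoch q q (2 * n))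
          = 1 / qpoch_inf q q * (\<Sum>\<^sub>\<infinity>k::int. (-1) ^ nat \<bar>k\<bar> * q ^ nat (3 * k\<^sup>2 - k)) \<and>
        1 / qpoch_inf q q * (\<Sum>\<^sub>\<infinity>k::int. (-1) ^ nat \<bar>k\<bar> * q ^ nat (3 * k\<^sup>2 - k))
          = qpoch_inf (q\<^sup>2) (q\<^sup>2) / qpoch_inf q q \<and>
        qpoch_inf (q\<^sup>2) (q\<^sup>2) / qpoch_inf q q = qpoch_inf (- q) q)"
proof -
  \<comment> \<open>The value is 1/2, as \<open>fps_X\<close> has subdegree 1.\<close>
  have "mag (fps_X :: 'a fps) < 1"
    by (simp add: mag_def dist_fps_def)
  then show ?thesis
    unfolding Let_def
    \<comment> \<open>\<open>/\<close> and \<open>div\<close> denote the same constant, so both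
      conjuncts are instances of the class statement.\<close>
    by (rule conjI[OF even_euler_sum_eq_products])
       (intro allI impI even_euler_sum_eq_products, simp add: mag_def)
qed

end
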